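(* Fix $\lambda>0$, $\sigma>0$, $t\in\mathbb{R}$ and $T>0$. For the pre-scheduled random arrivals process, let $n_1$ and $n_2$ be the numbers of arrivals in $(t,t+T]$ and $(t+T,t+2T]$ respectively, and let $p_i(a,b)=P(t_i\in(a,b])$ be the probability that the $i$-th client arrives in $(a,b]$. Then $$\mathrm{Cov}(n_1,n_2)=-\sum_{i\in\mathbb{Z}}p_i(t,t+T)\,p_i(t+T,t+2T).$$
   Context: Pre-scheduled random arrivals (PSRA) process: for $\lambda>0$, the arrival time of the $i$-th client is $t_i=\frac{i}{\lambda}+\xi_i$, $i\in\mathbb{Z}$, where the $\xi_i$ are i.i.d. real random variables with mean $0$, variance $\sigma^2$ and continuous probability density $f^{(\sigma)}_\xi$. It is assumed that $f^{(\sigma)}_\xi(x)=\frac1\sigma f_\xi(x/\sigma)$, where $f_\xi$ is a fixed (independent of $\sigma$) continuous probability density with finite variance and finite maximum. The number of arrivals in an interval $(a,b]$ is the number of $i\in\mathbb{Z}$ with $t_i\in(a,b]$. *)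

theory Defs
  imports "HOL-Probability.Probability"
begin

definition covariance :: "'a measure \<Rightarrow> ('a \<Rightarrow> real) \<Rightarrow> ('a \<Rightarrow> real) \<Rightarrow> real" where
  "covariance M X Y =
     (\<integral>\<omega>. (X \<omega> - integral\<^sup>L M X) * (Y \<omega> - integral\<^sup>L M Y) \<partial>M)"

definition arrival_time :: "real \<Rightarrow> (int \<Rightarrow> 'a \<Rightarrow> real) \<Rightarrow> int \<Rightarrow> 'a \<Rightarrow> real" where
  "arrival_time lam \<xi> i \<omega> = real_of_int i / lam + \<xi> i \<omega>"

definition arrivals :: "real \<Rightarrow> (int \<Rightarrow> 'a \<Rightarrow> real) \<Rightarrow> real \<Rightarrow> real \<Rightarrow> 'a \<Rightarrow> int set" where
  "arrivals lam \<xi> a b \<omega> = {i. arrival_time lam \<xi> i \<omega> \<in> {a<..b}}"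

text \<open>As card is 0 on infinite sets, this is the number of arrivals only at those outcomes
  where the set of arriving clients is finite.\<close>

definition num_arrivals :: "real \<Rightarrow> (int \<Rightarrow> 'a \<Rightarrow> real) \<Rightarrow> real \<Rightarrow> real \<Rightarrow> 'a \<Rightarrow> real" where
  "num_arrivals lam \<xi> a b \<omega> = real (card (arrivals lam \<xi> a b \<omega>))"

definition arrival_prob ::
    "'a measure \<Rightarrow> real \<Rightarrow> (int \<Rightarrow> 'a \<Rightarrow> real) \<Rightarrow> int \<Rightarrow> real \<Rightarrow> real \<Rightarrow> real" where
  "arrival_prob M lam \<xi> i a b =
     measure M {\<omega> \<in> space M. arrival_time lam \<xi> i \<omega> \<in> {a<..b}}"

text \<open>The base density \<open>f\<close> has a finite second moment, equivalently, for a probability density,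
  a finite variance. That the \<open>\<xi> i\<close> are identically distributed is part of \<open>xi_density\<close>.\<close>

locale psra = prob_space M for M :: "'a measure" +
  fixes lam \<sigma> :: real and f :: "real \<Rightarrow> real" and \<xi> :: "int \<Rightarrow> 'a \<Rightarrow> real"
  assumes lam_pos: "lam > 0"
    and sigma_pos: "\<sigma> > 0"
    and f_continuous: "continuous_on UNIV f"
    and f_nonneg: "\<And>x. f x \<ge> 0"
    and f_integrable: "integrable lborel f"
    and f_total: "(\<integral>x. f x \<partial>lborel) = 1"
    and f_second_moment: "integrable lborel (\<lambda>x. x\<^sup>2 * f x)"
    and f_maximum: "\<exists>x0. \<forall>x. f x \<le> f x0"
    and xi_indep: "indep_vars (\<lambda>_. borel) \<xi> UNIV"
    and xi_density: "\<And>i. distributed M lborel (\<xi> i) (\<lambda>x. ennreal (1 / \<sigma> * f (x / \<sigma>)))"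
    and xi_square_integrable: "\<And>i. integrable M (\<lambda>\<omega>. (\<xi> i \<omega>)\<^sup>2)"
    and xi_mean: "\<And>i. expectation (\<xi> i) = 0"
    and xi_variance: "\<And>i. variance (\<xi> i) = \<sigma>\<^sup>2"

end

(* Each n is a sum of indicators of the events that client i arrives in the interval. The
   probabilities of these events have a finite sum, because all xi_i have the same law and a shifted
   lattice of spacing 1/lam has at most lam T + 1 points in an interval of length T. Hence
   E[n1 n2] is the double sum of P(i arrives in the first, j in the second interval). By
   independence the off-diagonal terms are p_i q_j, while the diagonal terms vanish because the
   intervals are disjoint; subtracting E[n1] E[n2] leaves minus the sum of p_i q_i. *)

theory Submission
  imports Defs
begin

section \<open>Counting occurrences in a sequence of events\<close>

text \<open>The partial sums stop growing beyond the largest index that occurs. Finiteness is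
  essential, as \<open>card\<close> is 0 on infinite sets while the partial sums would
  diverge.\<close>

lemma eventually_sum_indicator_eq_card:
  fixes A :: "nat \<Rightarrow> 'a set"
  assumes "finite {k. x \<in> A k}"
  shows "\<forall>\<^sub>F n in sequentially. (\<Sum>k<n. indicator (A k) x :: real) = real (card {k. x \<in> A k})"
proof -
  obtain m where m: "{k. x \<in> A k} \<subseteq> {..<m}"
    using assms finite_nat_bounded by blast
  have "(\<Sum>k<n. indicator (A k) x :: real) = real (card {k. x \<in> A k})" if "n \<ge> m" for n
  proof -
    have "(\<Sum>k<n. indicator (A k) x :: real) = (\<Sum>k\<in>{..<n} \<inter> {k. x \<in> A k}. 1)"
      by (simp only: sum.inter_restrict[OF finite_lessThan] indicator_def mem_Collect_eq of_bool_def)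
    also have "{..<n} \<inter> {k. x \<in> A k} = {k. x \<in> A k}"
      using m that by auto
    finally show ?thesis by simp
  qed
  then show ?thesis
    unfolding eventually_sequentially by blast
qed

text \<open>First Borel-Cantelli lemma: almost surely only finitely many events occur, so
  \<open>card\<close> is a true count outside a null set.\<close>

lemma (in prob_space) AE_finite_occurrences:
  fixes A :: "nat \<Rightarrow> 'a set"
  assumes "\<And>k. A k \<in> events" "summable (\<lambda>k. prob (A k))"
  shows "AE x in M. finite {k. x \<in> A k}"
proof -
  have "AE x in M. eventually (\<lambda>n. x \<in> space M - A n) sequentially"
    using assms by (intro borel_cantelli_AE1) (auto simp: less_top[symmetric])
  then show ?thesis
  proof eventually_elim
    case (elim x)
    then obtain m where "\<And>n. n \<ge> m \<Longrightarrow> x \<notin> A n"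
      by (auto simp: eventually_sequentially)
    then have "{k. x \<in> A k} \<subseteq> {..<m}"
      by (auto simp: not_le[symmetric])
    then show ?case
      using finite_subset by blast
  qed
qed

lemma card_occurrences_measurable [measurable]:
  fixes A :: "nat \<Rightarrow> 'a set"
  assumes [measurable]: "\<And>k. A k \<in> sets M"
  shows "(\<lambda>x. real (card {k. x \<in> A k})) \<in> borel_measurable M"
proof -
  have "{x \<in> space M. i \<in> {k. x \<in> A k}} \<in> sets M" for i
    by simp
  from measurable_card[OF this] show ?thesis
    by measurable
qed

text \<open>Monotone convergence applied to the partial sums of the indicators, whose almost sure
  limit is the count.\<close>

lemma (in prob_space) has_bochner_integral_card_occurrences:
  fixes A :: "nat \<Rightarrow> 'a set"
  assumes A [measurable]: "\<And>k. A k \<in> events" and sA: "summable (\<lambda>k. prob (A k))"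
  shows "has_bochner_integral M (\<lambda>x. real (card {k. x \<in> A k})) (\<Sum>k. prob (A k))"
proof (rule has_bochner_integral_monotone_convergence[where f = "\<lambda>n x. \<Sum>k<n. indicator (A k) x"])
  show "integrable M (\<lambda>x. \<Sum>k<n. indicator (A k) x :: real)" for n
    by (simp add: less_top[symmetric])
  show "AE x in M. mono (\<lambda>n. \<Sum>k<n. indicator (A k) x :: real)"
    by (intro AE_I2 monoI sum_mono2) auto
  show "AE x in M. (\<lambda>n. \<Sum>k<n. indicator (A k) x :: real) \<longlonglongrightarrow> real (card {k. x \<in> A k})"
    using AE_finite_occurrences[OF A sA]
    by eventually_elim (rule tendsto_eventually, rule eventually_sum_indicator_eq_card)
  show "(\<lambda>n. \<integral>x. (\<Sum>k<n. indicator (A k) x :: real) \<partial>M) \<longlonglongrightarrow> (\<Sum>k. prob (A k))"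
    using summable_LIMSEQ[OF sA] by (simp add: less_top[symmetric])
qed simp

text \<open>Only pairs with distinct indices are independent, so the diagonal of the double sum
  is corrected separately.\<close>

lemma (in prob_space) has_bochner_integral_card_occurrences_mult:
  fixes A B :: "nat \<Rightarrow> 'a set"
  assumes A [measurable]: "\<And>k. A k \<in> events" and sA: "summable (\<lambda>k. prob (A k))"
    and B [measurable]: "\<And>k. B k \<in> events" and sB: "summable (\<lambda>k. prob (B k))"
    and indep: "\<And>j k. j \<noteq> k \<Longrightarrow> prob (A j \<inter> B k) = prob (A j) * prob (B k)"
  shows "has_bochner_integral M (\<lambda>x. real (card {k. x \<in> A k}) * real (card {k. x \<in> B k}))
    ((\<Sum>k. prob (A k)) * (\<Sum>k. prob (B k)) - (\<Sum>k. prob (A k) * prob (B k))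
      + (\<Sum>k. prob (A k \<inter> B k)))"
    (is "has_bochner_integral M _ ?L")
proof (rule has_bochner_integral_monotone_convergence
    [where f = "\<lambda>n x. (\<Sum>k<n. indicator (A k) x) * (\<Sum>k<n. indicator (B k) x)"])
  have expand: "(\<Sum>k<n. indicator (A k) x) * (\<Sum>k<n. indicator (B k) x :: real)
      = (\<Sum>j<n. \<Sum>k<n. indicator (A j \<inter> B k) x)" for n x
    by (simp add: sum_product indicator_inter_arith)
  show "integrable M (\<lambda>x. (\<Sum>k<n. indicator (A k) x) * (\<Sum>k<n. indicator (B k) x :: real))" for n
    unfolding expand
    by (simp add: less_top[symmetric])
  \<comment> \<open>Both factors are truncated at the same \<open>n\<close>, so the product is
    increasing in \<open>n\<close> and one monotone limit handles the double sum.\<close>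
  show "AE x in M. mono (\<lambda>n. (\<Sum>k<n. indicator (A k) x) * (\<Sum>k<n. indicator (B k) x :: real))"
    by (intro AE_I2 monoI mult_mono sum_mono2 sum_nonneg) auto
  show "AE x in M. (\<lambda>n. (\<Sum>k<n. indicator (A k) x) * (\<Sum>k<n. indicator (B k) x :: real))
      \<longlonglongrightarrow> real (card {k. x \<in> A k}) * real (card {k. x \<in> B k})"
    using AE_finite_occurrences[OF A sA] AE_finite_occurrences[OF B sB]
    by eventually_elim (intro tendsto_mult tendsto_eventually eventually_sum_indicator_eq_card)
  have "(\<integral>x. (\<Sum>k<n. indicator (A k) x) * (\<Sum>k<n. indicator (B k) x :: real) \<partial>M)
      = (\<Sum>k<n. prob (A k)) * (\<Sum>k<n. prob (B k)) - (\<Sum>k<n. prob (A k) * prob (B k))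
        + (\<Sum>k<n. prob (A k \<inter> B k))" for n
  proof -
    have "(\<integral>x. (\<Sum>k<n. indicator (A k) x) * (\<Sum>k<n. indicator (B k) x :: real) \<partial>M)
        = (\<Sum>j<n. \<Sum>k<n. prob (A j \<inter> B k))"
      unfolding expand by (simp add: less_top[symmetric])
    \<comment> \<open>The product form is written for all pairs; the conditional term restores the
      true probability on the diagonal.\<close>
    also have "\<dots> = (\<Sum>j<n. \<Sum>k<n. prob (A j) * prob (B k)
        + (if j = k then prob (A j \<inter> B j) - prob (A j) * prob (B j) else 0))"
      by (intro sum.cong) (auto simp: indep)
    also have "\<dots> = (\<Sum>k<n. prob (A k)) * (\<Sum>k<n. prob (B k))
        + (\<Sum>k<n. prob (A k \<inter> B k) - prob (A k) * prob (B k))"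
      by (simp add: sum.distrib sum_product)
    finally show ?thesis
      by (simp add: sum_subtractf)
  qed
  \<comment> \<open>Both diagonal series are dominated termwise by
    \<open>prob (A k)\<close>.\<close>
  moreover have "summable (\<lambda>k. prob (A k) * prob (B k))"
    by (rule summable_comparison_test'[OF sA, of 0]) (auto simp: mult_left_le)
  moreover have "summable (\<lambda>k. prob (A k \<inter> B k))"
    by (rule summable_comparison_test'[OF sA, of 0]) (auto intro: finite_measure_mono)
  ultimately show "(\<lambda>n. \<integral>x. (\<Sum>k<n. indicator (A k) x) * (\<Sum>k<n. indicator (B k) x :: real) \<partial>M)
      \<longlonglongrightarrow> ?L"
    by (simp only:) (intro tendsto_intros summable_LIMSEQ sA sB)
qed simp

section \<open>Lattice points in an interval\<close>

text \<open>The bound does not depend on the shift \<open>x\<close>, so it survives averaging over a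
  random shift.\<close>

lemma card_int_shifts_le:
  fixes lam a b x :: real
  assumes "lam > 0" "a \<le> b"
  shows "finite {i. real_of_int i / lam + x \<in> {a<..b}}"
    and "real (card {i. real_of_int i / lam + x \<in> {a<..b}}) \<le> lam * (b - a) + 1"
proof -
  \<comment> \<open>Multiplying by \<open>lam > 0\<close> turns the condition into
    \<open>lam * (a - x) < i\<close> and \<open>i \<le> lam * (b - x)\<close>; for an integer
    \<open>i\<close> both bounds may be replaced by their floors. Rounding costs at most the
    \<open>+ 1\<close> in the count.\<close>
  have eq: "{i. real_of_int i / lam + x \<in> {a<..b}} = {\<lfloor>lam * (a - x)\<rfloor><..\<lfloor>lam * (b - x)\<rfloor>}"
    using assms by (auto simp: floor_less_iff le_floor_iff field_simps)
  show "finite {i. real_of_int i / lam + x \<in> {a<..b}}"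
    unfolding eq by simp
  have le: "\<lfloor>lam * (a - x)\<rfloor> \<le> \<lfloor>lam * (b - x)\<rfloor>"
    using assms by (intro floor_mono) auto
  have "real_of_int (\<lfloor>lam * (b - x)\<rfloor> - \<lfloor>lam * (a - x)\<rfloor>) \<le> lam * (b - x) - lam * (a - x) + 1"
    by linarith
  then show "real (card {i. real_of_int i / lam + x \<in> {a<..b}}) \<le> lam * (b - a) + 1"
    unfolding eq using le by (simp add: algebra_simps)
qed

section \<open>Arrival events and moments of the arrival counts\<close>

context psra
begin

definition arrival_event :: "real \<Rightarrow> real \<Rightarrow> int \<Rightarrow> 'a set" where
  "arrival_event a b i = {\<omega> \<in> space M. arrival_time lam \<xi> i \<omega> \<in> {a<..b}}"

lemma prob_arrival_event: "prob (arrival_event a b i) = arrival_prob M lam \<xi> i a b"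
  by (simp add: arrival_event_def arrival_prob_def)

lemma xi_measurable [measurable]: "\<xi> i \<in> borel_measurable M"
  using distributed_measurable[OF xi_density] by simp

text \<open>As a preimage under \<open>\<xi> i\<close>, the event is accessible both to the common
  law and to independence of the \<open>\<xi> i\<close>.\<close>

lemma arrival_event_vimage:
  "arrival_event a b i = \<xi> i -` {x. real_of_int i / lam + x \<in> {a<..b}} \<inter> space M"
  by (auto simp: arrival_event_def arrival_time_def)

lemma arrival_event_sets [measurable]: "arrival_event a b i \<in> events"
  unfolding arrival_event_def arrival_time_def by measurable

text \<open>By the common law of the \<open>\<xi> i\<close>, the sum over \<open>i\<close> is the expected number of points
  of a single randomly shifted lattice in the interval.\<close>

lemma sum_arrival_prob_le:
  assumes "a \<le> b" "finite F"
  shows "(\<Sum>i\<in>F. arrival_prob M lam \<xi> i a b) \<le> lam * (b - a) + 1"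
proof -
  define S where "S i = {x. real_of_int i / lam + x \<in> {a<..b}}" for i
  have S [measurable]: "S i \<in> sets borel" for i
    unfolding S_def by measurable
  \<comment> \<open>All clients are given the same displacement \<open>\<xi> 0\<close>. This changes
    the joint law but no single probability, and the expected count depends only on the
    latter.\<close>
  define E where "E i = \<xi> 0 -` S i \<inter> space M" for i
  have E [measurable]: "E i \<in> events" for i
    unfolding E_def by measurable
  have same: "arrival_prob M lam \<xi> i a b = prob (E i)" for i
  proof -
    have "distr M lborel (\<xi> i) = distr M lborel (\<xi> 0)"
      using xi_density[of i] xi_density[of 0] by (simp add: distributed_def)
    then have "measure (distr M lborel (\<xi> i)) (S i) = measure (distr M lborel (\<xi> 0)) (S i)"
      by simp
    then show ?thesis
      unfolding prob_arrival_event[symmetric] arrival_event_vimage E_def S_def[symmetric]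
      by (simp add: measure_distr)
  qed
  have "(\<Sum>i\<in>F. arrival_prob M lam \<xi> i a b) = expectation (\<lambda>\<omega>. \<Sum>i\<in>F. indicator (E i) \<omega>)"
    by (simp add: same less_top[symmetric])
  also have "\<dots> \<le> expectation (\<lambda>\<omega>. lam * (b - a) + 1)"
  proof (rule integral_mono)
    fix \<omega>
    let ?C = "{i. real_of_int i / lam + \<xi> 0 \<omega> \<in> {a<..b}}"
    have "(\<Sum>i\<in>F. indicator (E i) \<omega>) \<le> (\<Sum>i\<in>F. indicator ?C i :: real)"
      by (intro sum_mono) (auto simp: E_def S_def indicator_def)
    also have "\<dots> = real (card (F \<inter> ?C))"
      using \<open>finite F\<close> by (simp add: indicator_def sum.If_cases Int_def of_bool_def)
    also have "\<dots> \<le> real (card ?C)"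
      using card_int_shifts_le(1)[OF lam_pos assms(1)] by (intro of_nat_mono card_mono) auto
    also have "\<dots> \<le> lam * (b - a) + 1"
      by (rule card_int_shifts_le(2)[OF lam_pos assms(1)])
    finally show "(\<Sum>i\<in>F. indicator (E i) \<omega>) \<le> lam * (b - a) + 1" .
  qed (simp_all add: less_top[symmetric])
  also have "\<dots> = lam * (b - a) + 1"
    by (simp add: prob_space)
  finally show ?thesis .
qed

lemma summable_on_arrival_prob:
  assumes "a \<le> b"
  shows "(\<lambda>i. arrival_prob M lam \<xi> i a b) summable_on UNIV"
  using sum_arrival_prob_le[OF assms]
  by (intro nonneg_bdd_above_summable_on) (auto intro!: bdd_aboveI2 simp: arrival_prob_def)

text \<open>The bijection \<open>int_decode\<close> enumerates the clients by natural numbers, the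
  index type of the counting lemmas.\<close>

lemma summable_arrival_event:
  assumes "a \<le> b"
  shows "summable (\<lambda>k. prob (arrival_event a b (int_decode k)))"
  using iffD2[OF summable_on_reindex_bij_betw[OF bij_int_decode] summable_on_arrival_prob[OF assms]]
  unfolding prob_arrival_event by (rule summable_on_imp_summable)

lemma prob_arrival_event_Int:
  assumes "i \<noteq> j"
  shows "prob (arrival_event a b i \<inter> arrival_event c d j)
    = prob (arrival_event a b i) * prob (arrival_event c d j)"
proof -
  \<comment> \<open>Independence is stated for one family of Borel sets, so the two intervals are
    merged into one family by cases on the index; this is consistent because
    \<open>i \<noteq> j\<close>.\<close>
  define S where "S k = {x. real_of_int k / lam + x \<in> (if k = i then {a<..b} else {c<..d})}" for k
  have "S k \<in> sets borel" for k
    unfolding S_def by (cases "k = i") simp_all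
  then have "prob (\<Inter>k\<in>{i, j}. \<xi> k -` S k \<inter> space M) = (\<Prod>k\<in>{i, j}. prob (\<xi> k -` S k \<inter> space M))"
    by (intro indep_varsD[OF xi_indep]) auto
  then show ?thesis
    using assms by (simp add: S_def arrival_event_vimage)
qed

lemma arrivals_int_decode:
  assumes "\<omega> \<in> space M"
  shows "arrivals lam \<xi> a b \<omega> = int_decode ` {k. \<omega> \<in> arrival_event a b (int_decode k)}"
proof -
  have "i \<in> int_decode ` {k. \<omega> \<in> arrival_event a b (int_decode k)} \<longleftrightarrow> \<omega> \<in> arrival_event a b i" for i
    by (auto intro!: image_eqI[where x = "int_encode i"])
  then show ?thesis
    using assms by (simp add: set_eq_iff) (simp add: arrivals_def arrival_event_def)
qed

lemma num_arrivals_int_decode: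
  assumes "\<omega> \<in> space M"
  shows "num_arrivals lam \<xi> a b \<omega> = real (card {k. \<omega> \<in> arrival_event a b (int_decode k)})"
  unfolding num_arrivals_def arrivals_int_decode[OF assms] by (simp add: card_image inj_int_decode)

lemma AE_finite_arrivals:
  assumes "a \<le> b"
  shows "AE \<omega> in M. finite (arrivals lam \<xi> a b \<omega>)"
  using AE_finite_occurrences[OF _ summable_arrival_event[OF assms], simplified] AE_space
  by eventually_elim (simp add: arrivals_int_decode)

lemma has_bochner_integral_num_arrivals:
  assumes "a \<le> b"
  shows "has_bochner_integral M (num_arrivals lam \<xi> a b)
    (\<Sum>k. prob (arrival_event a b (int_decode k)))"
  using has_bochner_integral_card_occurrences[OF _ summable_arrival_event[OF assms]]
  by (subst has_bochner_integral_cong[OF refl num_arrivals_int_decode refl]) simp_all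

text \<open>The two intervals may overlap. Equal intervals give the second moments, adjacent ones
  the mixed moment in the covariance.\<close>

lemma has_bochner_integral_num_arrivals_mult:
  assumes "a \<le> b" "c \<le> d"
  shows "has_bochner_integral M (\<lambda>\<omega>. num_arrivals lam \<xi> a b \<omega> * num_arrivals lam \<xi> c d \<omega>)
    ((\<Sum>k. prob (arrival_event a b (int_decode k))) * (\<Sum>k. prob (arrival_event c d (int_decode k)))
      - (\<Sum>k. prob (arrival_event a b (int_decode k)) * prob (arrival_event c d (int_decode k)))
      + (\<Sum>k. prob (arrival_event a b (int_decode k) \<inter> arrival_event c d (int_decode k))))"
    (is "has_bochner_integral M _ ?L")
proof -
  have "has_bochner_integral M (\<lambda>\<omega>. real (card {k. \<omega> \<in> arrival_event a b (int_decode k)})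
      * real (card {k. \<omega> \<in> arrival_event c d (int_decode k)})) ?L"
    by (intro has_bochner_integral_card_occurrences_mult summable_arrival_event assms
        prob_arrival_event_Int) (auto simp: int_decode_eq)
  then show ?thesis
    by (rule iffD1[OF has_bochner_integral_cong, rotated -1])
      (simp_all add: num_arrivals_int_decode)
qed

end

section \<open>The covariance\<close>

lemma (in prob_space) covariance_eq:
  assumes "integrable M X" "integrable M Y" "integrable M (\<lambda>\<omega>. X \<omega> * Y \<omega>)"
  shows "covariance M X Y = expectation (\<lambda>\<omega>. X \<omega> * Y \<omega>) - expectation X * expectation Y"
proof -
  have "covariance M X Y = expectation (\<lambda>\<omega>. X \<omega> * Y \<omega> - expectation Y * X \<omega>
      - expectation X * Y \<omega> + expectation X * expectation Y)"
    unfolding covariance_def by (simp add: algebra_simps)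
  also have "\<dots> = expectation (\<lambda>\<omega>. X \<omega> * Y \<omega>) - expectation X * expectation Y"
    using assms by (simp add: prob_space)
  finally show ?thesis .
qed

text \<open>The conjuncts before the covariance formula rule out default values: \<open>card\<close>
  is 0 on infinite sets, the integral is 0 for non-integrable functions, and the infinite sum is 0
  without summability.\<close>

theorem mainTheorem2:
  fixes M :: "'a measure" and lam \<sigma> t T :: real
    and f :: "real \<Rightarrow> real" and \<xi> :: "int \<Rightarrow> 'a \<Rightarrow> real"
    and n1 n2 :: "'a \<Rightarrow> real"
  assumes "psra M lam \<sigma> f \<xi>"
    and "T > 0"
  defines "n1 \<equiv> num_arrivals lam \<xi> t (t + T)"
    and "n2 \<equiv> num_arrivals lam \<xi> (t + T) (t + 2 * T)"
  shows "(AE \<omega> in M. finite (arrivals lam \<xi> t (t + T) \<omega>)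
                    \<and> finite (arrivals lam \<xi> (t + T) (t + 2 * T) \<omega>))
    \<and> integrable M (\<lambda>\<omega>. (n1 \<omega>)\<^sup>2) \<and> integrable M (\<lambda>\<omega>. (n2 \<omega>)\<^sup>2)
    \<and> (\<lambda>i. arrival_prob M lam \<xi> i t (t + T)
            * arrival_prob M lam \<xi> i (t + T) (t + 2 * T)) summable_on UNIV
    \<and> covariance M n1 n2 =
        - (\<Sum>\<^sub>\<infinity>i\<in>UNIV. arrival_prob M lam \<xi> i t (t + T)
                      * arrival_prob M lam \<xi> i (t + T) (t + 2 * T))"
proof -
  interpret psra M lam \<sigma> f \<xi> by fact
  let ?p = "\<lambda>i. arrival_prob M lam \<xi> i t (t + T)"
  let ?q = "\<lambda>i. arrival_prob M lam \<xi> i (t + T) (t + 2 * T)"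
  have le: "t \<le> t + T" "t + T \<le> t + 2 * T"
    using \<open>T > 0\<close> by auto
  have fin: "AE \<omega> in M. finite (arrivals lam \<xi> t (t + T) \<omega>)
                    \<and> finite (arrivals lam \<xi> (t + T) (t + 2 * T) \<omega>)"
    using AE_finite_arrivals[OF le(1)] AE_finite_arrivals[OF le(2)] by eventually_elim simp
  have sq: "integrable M (\<lambda>\<omega>. (n1 \<omega>)\<^sup>2)" "integrable M (\<lambda>\<omega>. (n2 \<omega>)\<^sup>2)"
    using has_bochner_integral_num_arrivals_mult[OF le(1) le(1)]
      has_bochner_integral_num_arrivals_mult[OF le(2) le(2)]
    by (auto simp: n1_def n2_def power2_eq_square has_bochner_integral_iff)
  have summ: "(\<lambda>i. ?p i * ?q i) summable_on UNIV"
    by (rule summable_on_comparison_test[OF summable_on_arrival_prob[OF le(1)]])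
      (auto simp: arrival_prob_def mult_left_le)
  \<comment> \<open>The common endpoint \<open>t + T\<close> lies in the first half-open interval
    only.\<close>
  have disj: "arrival_event t (t + T) i \<inter> arrival_event (t + T) (t + 2 * T) i = {}" for i
    by (auto simp: arrival_event_def)
  \<comment> \<open>The unordered sum over the integers becomes the series along
    \<open>int_decode\<close> in which the moments are expressed.\<close>
  have "(\<lambda>k. ?p (int_decode k) * ?q (int_decode k)) sums (\<Sum>\<^sub>\<infinity>i. ?p i * ?q i)"
    using summ by (intro has_sum_imp_sums)
      (simp add: has_sum_reindex_bij_betw[OF bij_int_decode, of "\<lambda>i. ?p i * ?q i"])
  \<comment> \<open>The product of the two means cancels and the intersection terms vanish by
    \<open>disj\<close>, leaving minus the diagonal series.\<close>
  then have "covariance M n1 n2 = - (\<Sum>\<^sub>\<infinity>i. ?p i * ?q i)"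
    using has_bochner_integral_num_arrivals[OF le(1)] has_bochner_integral_num_arrivals[OF le(2)]
      has_bochner_integral_num_arrivals_mult[OF le]
    unfolding has_bochner_integral_iff n1_def n2_def
    by (subst covariance_eq) (auto simp: disj prob_arrival_event sums_iff)
  with fin sq summ show ?thesis
    by simp
qed

end
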